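(* Let $R$ be a commutative ring with unity and let $E$ be a directed graph. If the Leavitt path algebra $L_R(E)$ is dextral symmetric, then it is isomorphic to $$\bigoplus_{I} R\ \oplus\ \bigoplus_{J} R[x,x^{-1}]$$ for some index sets $I$ and $J$, where $R[x,x^{-1}]$ is the Laurent polynomial algebra over $R$.
   Context: A (not necessarily associative) algebra $A$ is dextral symmetric if for all $a,b,c\in A$, $a(bc)=0$ implies $b(ac)=0$. A graph is a directed graph $E=(E^0,E^1,r,s)$ with $E^0$ (vertices) and $E^1$ (edges) countable sets and maps $r,s:E^1\to E^0$ (range and source). A vertex is regular if it emits a nonempty finite set of edges. For each edge $e$ there is a ghost edge $e^*$ with $s(e^* )=r(e)$ and $r(e^* )=s(e)$. The Leavitt path algebra $L_R(E)$ is the (associative, not necessarily unital) $R$-algebra generated by a set of pairwise orthogonal idempotents $\{v : v\in E^0\}$ together with $\{e,e^* : e\in E^1\}$, subject to: (1) $s(e)e=e=e\,r(e)$ for all $e\in E^1$; (2) $r(e)e^*=e^*=e^*s(e)$ for all $e\in E^1$; (3) $e^*e=r(e)$ and $e^*f=0$ for all $e,f\in E^1$ with $e\ne f$; (4) $v=\sum_{e\in E^1,\ s(e)=v} ee^*$ for every regular vertex $v\in E^0$. Isomorphism is as $R$-algebras, and direct sums carry componentwise multiplication. *)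

theory Defs
  imports "HOL-Library.Poly_Mapping" "HOL-Library.FuncSet" "HOL-Library.Countable_Set"
    "Graph_Theory.Digraph"
begin

text \<open>
  Commutative rings with unity are types of sort \<open>{comm_ring, comm_monoid_mult}\<close>. In contrast
  to \<^class>\<open>comm_ring_1\<close>, this sort does not impose \<open>0 \<noteq> 1\<close>, so it also covers the zero ring.
\<close>

section \<open>Algebras over a commutative ring\<close>

record ('r, 'a) algebra =
  acarrier :: "'a set"
  azero :: 'a
  aadd :: "'a \<Rightarrow> 'a \<Rightarrow> 'a"
  amult :: "'a \<Rightarrow> 'a \<Rightarrow> 'a"
  ascale :: "'r \<Rightarrow> 'a \<Rightarrow> 'a"

text \<open>Neither a unit nor associativity of the multiplication is required.\<close>

locale nonassoc_algebra =
  fixes A :: "('r::{comm_ring, comm_monoid_mult}, 'a) algebra"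
  assumes zero_closed: "azero A \<in> acarrier A"
    and add_closed: "\<lbrakk>a \<in> acarrier A; b \<in> acarrier A\<rbrakk> \<Longrightarrow> aadd A a b \<in> acarrier A"
    and mult_closed: "\<lbrakk>a \<in> acarrier A; b \<in> acarrier A\<rbrakk> \<Longrightarrow> amult A a b \<in> acarrier A"
    and scale_closed: "a \<in> acarrier A \<Longrightarrow> ascale A r a \<in> acarrier A"
    and add_assoc: "\<lbrakk>a \<in> acarrier A; b \<in> acarrier A; c \<in> acarrier A\<rbrakk> \<Longrightarrow>
      aadd A (aadd A a b) c = aadd A a (aadd A b c)"
    and add_commute: "\<lbrakk>a \<in> acarrier A; b \<in> acarrier A\<rbrakk> \<Longrightarrow> aadd A a b = aadd A b a"
    and add_zero: "a \<in> acarrier A \<Longrightarrow> aadd A (azero A) a = a"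
    and add_inverse: "a \<in> acarrier A \<Longrightarrow> \<exists>b\<in>acarrier A. aadd A a b = azero A"
    and scale_add_right: "\<lbrakk>a \<in> acarrier A; b \<in> acarrier A\<rbrakk> \<Longrightarrow>
      ascale A r (aadd A a b) = aadd A (ascale A r a) (ascale A r b)"
    and scale_add_left: "a \<in> acarrier A \<Longrightarrow>
      ascale A (r + s) a = aadd A (ascale A r a) (ascale A s a)"
    and scale_scale: "a \<in> acarrier A \<Longrightarrow> ascale A r (ascale A s a) = ascale A (r * s) a"
    and scale_one: "a \<in> acarrier A \<Longrightarrow> ascale A 1 a = a"
    and mult_add_left: "\<lbrakk>a \<in> acarrier A; b \<in> acarrier A; c \<in> acarrier A\<rbrakk> \<Longrightarrow>
      amult A (aadd A a b) c = aadd A (amult A a c) (amult A b c)"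
    and mult_add_right: "\<lbrakk>a \<in> acarrier A; b \<in> acarrier A; c \<in> acarrier A\<rbrakk> \<Longrightarrow>
      amult A a (aadd A b c) = aadd A (amult A a b) (amult A a c)"
    and mult_scale_left: "\<lbrakk>a \<in> acarrier A; b \<in> acarrier A\<rbrakk> \<Longrightarrow>
      amult A (ascale A r a) b = ascale A r (amult A a b)"
    and mult_scale_right: "\<lbrakk>a \<in> acarrier A; b \<in> acarrier A\<rbrakk> \<Longrightarrow>
      amult A a (ascale A r b) = ascale A r (amult A a b)"

definition dextral_symmetric :: "('r::{comm_ring, comm_monoid_mult}, 'a) algebra \<Rightarrow> bool" where
  "dextral_symmetric A \<longleftrightarrow>
    nonassoc_algebra A \<and>
    (\<forall>a\<in>acarrier A. \<forall>b\<in>acarrier A. \<forall>c\<in>acarrier A.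
      amult A a (amult A b c) = azero A \<longrightarrow> amult A b (amult A a c) = azero A)"

definition algebra_iso ::
    "('r::{comm_ring, comm_monoid_mult}, 'a) algebra \<Rightarrow> ('r, 'b) algebra \<Rightarrow> ('a \<Rightarrow> 'b) \<Rightarrow> bool" where
  "algebra_iso A B h \<longleftrightarrow>
    bij_betw h (acarrier A) (acarrier B) \<and>
    (\<forall>a\<in>acarrier A. \<forall>b\<in>acarrier A. h (aadd A a b) = aadd B (h a) (h b)) \<and>
    (\<forall>a\<in>acarrier A. \<forall>b\<in>acarrier A. h (amult A a b) = amult B (h a) (h b)) \<and>
    (\<forall>r. \<forall>a\<in>acarrier A. h (ascale A r a) = ascale B r (h a))"

definition algebra_isomorphic ::
    "('r::{comm_ring, comm_monoid_mult}, 'a) algebra \<Rightarrow> ('r, 'b) algebra \<Rightarrow> bool" where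
  "algebra_isomorphic A B \<longleftrightarrow> (\<exists>h. algebra_iso A B h)"

definition ground_algebra :: "('r::{comm_ring, comm_monoid_mult}, 'r) algebra" where
  "ground_algebra =
    \<lparr>acarrier = UNIV, azero = 0, aadd = (+), amult = (*), ascale = (*)\<rparr>"

text \<open>
  An element of \<open>int \<Rightarrow>\<^sub>0 'r\<close> maps \<open>n\<close> to the coefficient of \<open>x\<close> to the power \<open>n\<close>; the product
  on this type is convolution.
\<close>

definition laurent_algebra :: "('r::{comm_ring, comm_monoid_mult}, int \<Rightarrow>\<^sub>0 'r) algebra" where
  "laurent_algebra =
    \<lparr>acarrier = UNIV, azero = 0, aadd = (+), amult = (*),
     ascale = (\<lambda>r. Poly_Mapping.map ((*) r))\<rparr>"

definition direct_sum :: "'i set \<Rightarrow> ('i \<Rightarrow> ('r, 'a) algebra) \<Rightarrow> ('r, 'i \<Rightarrow> 'a) algebra" where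
  "direct_sum I A =
    \<lparr>acarrier = {f \<in> \<Pi>\<^sub>E i\<in>I. acarrier (A i). finite {i \<in> I. f i \<noteq> azero (A i)}},
     azero = (\<lambda>i\<in>I. azero (A i)),
     aadd = (\<lambda>f g. \<lambda>i\<in>I. aadd (A i) (f i) (g i)),
     amult = (\<lambda>f g. \<lambda>i\<in>I. amult (A i) (f i) (g i)),
     ascale = (\<lambda>r f. \<lambda>i\<in>I. ascale (A i) r (f i))\<rparr>"

definition binary_direct_sum ::
    "('r, 'a) algebra \<Rightarrow> ('r, 'b) algebra \<Rightarrow> ('r, 'a \<times> 'b) algebra" where
  "binary_direct_sum A B =
    \<lparr>acarrier = acarrier A \<times> acarrier B,
     azero = (azero A, azero B),
     aadd = (\<lambda>(a, b) (a', b'). (aadd A a a', aadd B b b')),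
     amult = (\<lambda>(a, b) (a', b'). (amult A a a', amult B b b')),
     ascale = (\<lambda>r (a, b). (ascale A r a, ascale B r b))\<rparr>"

section \<open>Associative algebras given by generators and relations\<close>

text \<open>
  The associative, not necessarily unital algebra generated by a set \<open>X\<close> subject to relations
  \<open>rel\<close> is the set of formal expressions over \<open>X\<close>, modulo the least congruence that contains
  \<open>rel\<close> and all instances of the axioms of associative algebras.
\<close>

datatype (dead 'r, gens: 'g) expr =
    Gen 'g
  | Zero
  | Neg "('r, 'g) expr"
  | Add "('r, 'g) expr" "('r, 'g) expr"
  | Mult "('r, 'g) expr" "('r, 'g) expr"
  | Scale 'r "('r, 'g) expr"

definition exprs :: "'g set \<Rightarrow> ('r, 'g) expr set" where
  "exprs X = {t. gens t \<subseteq> X}"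

inductive assoc_algebra_axiom ::
    "('r::{comm_ring, comm_monoid_mult}, 'g) expr \<Rightarrow> ('r, 'g) expr \<Rightarrow> bool" where
  add_assoc: "assoc_algebra_axiom (Add (Add a b) c) (Add a (Add b c))"
| add_commute: "assoc_algebra_axiom (Add a b) (Add b a)"
| add_zero: "assoc_algebra_axiom (Add Zero a) a"
| add_neg: "assoc_algebra_axiom (Add a (Neg a)) Zero"
| scale_add_right: "assoc_algebra_axiom (Scale r (Add a b)) (Add (Scale r a) (Scale r b))"
| scale_add_left: "assoc_algebra_axiom (Scale (r + s) a) (Add (Scale r a) (Scale s a))"
| scale_scale: "assoc_algebra_axiom (Scale r (Scale s a)) (Scale (r * s) a)"
| scale_one: "assoc_algebra_axiom (Scale 1 a) a"
| mult_assoc: "assoc_algebra_axiom (Mult (Mult a b) c) (Mult a (Mult b c))"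
| mult_add_left: "assoc_algebra_axiom (Mult (Add a b) c) (Add (Mult a c) (Mult b c))"
| mult_add_right: "assoc_algebra_axiom (Mult a (Add b c)) (Add (Mult a b) (Mult a c))"
| mult_scale_left: "assoc_algebra_axiom (Mult (Scale r a) b) (Scale r (Mult a b))"
| mult_scale_right: "assoc_algebra_axiom (Mult a (Scale r b)) (Scale r (Mult a b))"

inductive_set presented_cong ::
    "'g set \<Rightarrow> (('r::{comm_ring, comm_monoid_mult}, 'g) expr \<Rightarrow> ('r, 'g) expr \<Rightarrow> bool) \<Rightarrow>
     (('r, 'g) expr \<times> ('r, 'g) expr) set"
  for X rel where
  axiom: "\<lbrakk>assoc_algebra_axiom s t; s \<in> exprs X; t \<in> exprs X\<rbrakk> \<Longrightarrow> (s, t) \<in> presented_cong X rel"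
| relation: "\<lbrakk>rel s t; s \<in> exprs X; t \<in> exprs X\<rbrakk> \<Longrightarrow> (s, t) \<in> presented_cong X rel"
| refl: "t \<in> exprs X \<Longrightarrow> (t, t) \<in> presented_cong X rel"
| sym: "(s, t) \<in> presented_cong X rel \<Longrightarrow> (t, s) \<in> presented_cong X rel"
| trans: "\<lbrakk>(s, t) \<in> presented_cong X rel; (t, u) \<in> presented_cong X rel\<rbrakk> \<Longrightarrow>
    (s, u) \<in> presented_cong X rel"
| neg: "(s, t) \<in> presented_cong X rel \<Longrightarrow> (Neg s, Neg t) \<in> presented_cong X rel"
| add: "\<lbrakk>(s, t) \<in> presented_cong X rel; (s', t') \<in> presented_cong X rel\<rbrakk> \<Longrightarrow>
    (Add s s', Add t t') \<in> presented_cong X rel"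
| mult: "\<lbrakk>(s, t) \<in> presented_cong X rel; (s', t') \<in> presented_cong X rel\<rbrakk> \<Longrightarrow>
    (Mult s s', Mult t t') \<in> presented_cong X rel"
| scale: "(s, t) \<in> presented_cong X rel \<Longrightarrow> (Scale r s, Scale r t) \<in> presented_cong X rel"

definition presented_algebra ::
    "'g set \<Rightarrow> (('r::{comm_ring, comm_monoid_mult}, 'g) expr \<Rightarrow> ('r, 'g) expr \<Rightarrow> bool) \<Rightarrow>
     ('r, ('r, 'g) expr set) algebra" where
  "presented_algebra X rel = (let C = presented_cong X rel in
    \<lparr>acarrier = exprs X // C,
     azero = C `` {Zero},
     aadd = (\<lambda>A B. \<Union>a\<in>A. \<Union>b\<in>B. C `` {Add a b}),
     amult = (\<lambda>A B. \<Union>a\<in>A. \<Union>b\<in>B. C `` {Mult a b}),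
     ascale = (\<lambda>r A. \<Union>a\<in>A. C `` {Scale r a})\<rparr>)"

lemma exprs_simps [simp]:
  "Gen g \<in> exprs X \<longleftrightarrow> g \<in> X"
  "Zero \<in> exprs X"
  "Neg a \<in> exprs X \<longleftrightarrow> a \<in> exprs X"
  "Add a b \<in> exprs X \<longleftrightarrow> a \<in> exprs X \<and> b \<in> exprs X"
  "Mult a b \<in> exprs X \<longleftrightarrow> a \<in> exprs X \<and> b \<in> exprs X"
  "Scale r a \<in> exprs X \<longleftrightarrow> a \<in> exprs X"
  by (auto simp: exprs_def)

lemma presented_cong_exprs:
  assumes "(s, t) \<in> presented_cong X rel"
  shows "s \<in> exprs X \<and> t \<in> exprs X"
  using assms by induction auto

lemma equiv_presented_cong: "equiv (exprs X) (presented_cong X rel)"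
  by (rule equivI)
    (auto simp: refl_on_def dest: presented_cong_exprs
      intro!: symI transI intro: presented_cong.refl presented_cong.sym presented_cong.trans)

lemma presented_algebra_simps:
  fixes X :: "'g set"
    and rel :: "('r::{comm_ring, comm_monoid_mult}, 'g) expr \<Rightarrow> ('r, 'g) expr \<Rightarrow> bool"
  defines "C \<equiv> presented_cong X rel"
  shows "acarrier (presented_algebra X rel) = exprs X // C"
    and "azero (presented_algebra X rel) = C `` {Zero}"
    and "\<lbrakk>a \<in> exprs X; b \<in> exprs X\<rbrakk> \<Longrightarrow>
      aadd (presented_algebra X rel) (C `` {a}) (C `` {b}) = C `` {Add a b}"
    and "\<lbrakk>a \<in> exprs X; b \<in> exprs X\<rbrakk> \<Longrightarrow>
      amult (presented_algebra X rel) (C `` {a}) (C `` {b}) = C `` {Mult a b}"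
    and "a \<in> exprs X \<Longrightarrow> ascale (presented_algebra X rel) r (C `` {a}) = C `` {Scale r a}"
proof -
  have equiv: "equiv (exprs X) C"
    unfolding C_def by (rule equiv_presented_cong)
  have C_eq: "C `` {s} = C `` {t}" if "(s, t) \<in> C" for s t
    using equiv that by (rule equiv_class_eq)
  have cong2: "congruent2 C C (\<lambda>a b. C `` {f a b})"
    if "\<And>s t s' t'. (s, t) \<in> C \<Longrightarrow> (s', t') \<in> C \<Longrightarrow> (f s s', f t t') \<in> C" for f
    by (rule congruent2I') (use that C_eq in blast)
  have add: "congruent2 C C (\<lambda>a b. C `` {Add a b})"
    by (rule cong2) (auto simp: C_def intro: presented_cong.add)
  have mult: "congruent2 C C (\<lambda>a b. C `` {Mult a b})"
    by (rule cong2) (auto simp: C_def intro: presented_cong.mult)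
  have scale: "congruent C (\<lambda>a. C `` {Scale r a})" for r
    by (rule congruentI, rule C_eq) (auto simp: C_def intro: presented_cong.scale)
  show "acarrier (presented_algebra X rel) = exprs X // C"
    and "azero (presented_algebra X rel) = C `` {Zero}"
    by (simp_all add: presented_algebra_def Let_def C_def)
  show "aadd (presented_algebra X rel) (C `` {a}) (C `` {b}) = C `` {Add a b}"
    if "a \<in> exprs X" "b \<in> exprs X"
    using UN_equiv_class2[OF equiv equiv add that]
    by (simp add: presented_algebra_def Let_def C_def)
  show "amult (presented_algebra X rel) (C `` {a}) (C `` {b}) = C `` {Mult a b}"
    if "a \<in> exprs X" "b \<in> exprs X"
    using UN_equiv_class2[OF equiv equiv mult that]
    by (simp add: presented_algebra_def Let_def C_def)
  show "ascale (presented_algebra X rel) r (C `` {a}) = C `` {Scale r a}" if "a \<in> exprs X"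
    using UN_equiv_class[OF equiv scale that]
    by (simp add: presented_algebra_def Let_def C_def)
qed

lemma nonassoc_algebra_presented_algebra: "nonassoc_algebra (presented_algebra X rel)"
proof -
  let ?C = "presented_cong X rel"
  have C_eq: "?C `` {s} = ?C `` {t}"
    if "assoc_algebra_axiom s t" "s \<in> exprs X" "t \<in> exprs X" for s t
    using that by (intro equiv_class_eq[OF equiv_presented_cong] presented_cong.axiom)
  note [simp] = presented_algebra_simps
  show ?thesis
  proof
    fix a assume "a \<in> acarrier (presented_algebra X rel)"
    then obtain s where "a = ?C `` {s}" "s \<in> exprs X"
      by (auto elim: quotientE)
    moreover from this have "?C `` {Add s (Neg s)} = ?C `` {Zero}"
      by (intro C_eq assoc_algebra_axiom.intros) auto
    ultimately show "\<exists>b\<in>acarrier (presented_algebra X rel).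
        aadd (presented_algebra X rel) a b = azero (presented_algebra X rel)"
      by (intro bexI[of _ "?C `` {Neg s}"]) (simp_all add: quotientI)
  qed (unfold presented_algebra_simps(1),
      ((elim quotientE)?, simp?, (rule quotientI C_eq assoc_algebra_axiom.intros | simp; fail)+)+)
qed

section \<open>Leavitt path algebras\<close>

text \<open>The source and the range of an edge are its \<^const>\<open>tail\<close> and its \<^const>\<open>head\<close>.\<close>

datatype ('v, 'e) lpa_gen = Vertex 'v | Edge 'e | Ghost 'e

abbreviation vtx :: "'v \<Rightarrow> ('r, ('v, 'e) lpa_gen) expr" where
  "vtx v \<equiv> Gen (Vertex v)"

abbreviation edg :: "'e \<Rightarrow> ('r, ('v, 'e) lpa_gen) expr" where
  "edg e \<equiv> Gen (Edge e)"

abbreviation gho :: "'e \<Rightarrow> ('r, ('v, 'e) lpa_gen) expr" where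
  "gho e \<equiv> Gen (Ghost e)"

definition lpa_gens :: "('v, 'e) pre_digraph \<Rightarrow> ('v, 'e) lpa_gen set" where
  "lpa_gens E = Vertex ` verts E \<union> Edge ` arcs E \<union> Ghost ` arcs E"

definition regular_vertex :: "('v, 'e) pre_digraph \<Rightarrow> 'v \<Rightarrow> bool" where
  "regular_vertex E v \<longleftrightarrow> v \<in> verts E \<and> out_arcs E v \<noteq> {} \<and> finite (out_arcs E v)"

text \<open>
  In \<open>regular\<close>, the formal sum is taken along an arbitrary enumeration \<open>es\<close> of the edges emitted
  by \<open>v\<close>. By associativity and commutativity of addition, all enumerations give the same relation.
\<close>

inductive lpa_rel ::
    "('v, 'e) pre_digraph \<Rightarrow>
     ('r::{comm_ring, comm_monoid_mult}, ('v, 'e) lpa_gen) expr \<Rightarrow>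
     ('r, ('v, 'e) lpa_gen) expr \<Rightarrow> bool"
  for E where
  idempotent: "v \<in> verts E \<Longrightarrow> lpa_rel E (Mult (vtx v) (vtx v)) (vtx v)"
| orthogonal: "\<lbrakk>v \<in> verts E; w \<in> verts E; v \<noteq> w\<rbrakk> \<Longrightarrow> lpa_rel E (Mult (vtx v) (vtx w)) Zero"
| source_edge: "e \<in> arcs E \<Longrightarrow> lpa_rel E (Mult (vtx (tail E e)) (edg e)) (edg e)"
| edge_range: "e \<in> arcs E \<Longrightarrow> lpa_rel E (Mult (edg e) (vtx (head E e))) (edg e)"
| range_ghost: "e \<in> arcs E \<Longrightarrow> lpa_rel E (Mult (vtx (head E e)) (gho e)) (gho e)"
| ghost_source: "e \<in> arcs E \<Longrightarrow> lpa_rel E (Mult (gho e) (vtx (tail E e))) (gho e)"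
| ghost_edge: "e \<in> arcs E \<Longrightarrow> lpa_rel E (Mult (gho e) (edg e)) (vtx (head E e))"
| ghost_edge_neq: "\<lbrakk>e \<in> arcs E; f \<in> arcs E; e \<noteq> f\<rbrakk> \<Longrightarrow> lpa_rel E (Mult (gho e) (edg f)) Zero"
| regular: "\<lbrakk>regular_vertex E v; distinct es; set es = out_arcs E v\<rbrakk> \<Longrightarrow>
    lpa_rel E (vtx v) (foldr (\<lambda>e. Add (Mult (edg e) (gho e))) es Zero)"

definition leavitt_path_algebra ::
    "'r::{comm_ring, comm_monoid_mult} itself \<Rightarrow> ('v, 'e) pre_digraph \<Rightarrow>
     ('r, ('r, ('v, 'e) lpa_gen) expr set) algebra" where
  "leavitt_path_algebra _ E = presented_algebra (lpa_gens E) (lpa_rel E)"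

end

theory Submission
  imports Defs
begin

text \<open>
  Call a vertex zero if its class in \<open>L\<close> is zero, and an edge live if its range is not zero.
  Dextral symmetry forces a live edge \<open>e\<close> to be a loop with \<open>ee\<^sup>* = e\<^sup>*e\<close>, and a vertex to emit
  at most one live edge. Hence \<open>L\<close> is spanned by the nonzero vertices and the integer powers of the
  live loops. Sending a nonzero vertex to the unit of its own copy of \<open>R[x, x\<^sup>-\<^sup>1]\<close> and a live loop to
  the variable \<open>x\<close> there respects all relations, so it defines coordinates on \<open>L\<close>, which show
  that the spanning set is a basis. Since zero vertices are sent to zero, the general theorem that no
  vertex of a Leavitt path algebra over a nonzero ring vanishes is not needed.
\<close>

section \<open>Linear combinations in algebras\<close>

text \<open>Lists of pairs serve as formal linear combinations. Keys may repeat, so addition is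
  appending and no normal form has to be kept.\<close>

definition coef :: "('r::comm_monoid_add \<times> 'k) list \<Rightarrow> 'k \<Rightarrow> 'r" where
  "coef xs k = (\<Sum>(r, k')\<leftarrow>xs. if k' = k then r else 0)"

lemma coef_simps [simp]:
  "coef [] k = 0"
  "coef ((r, k') # xs) k = (if k' = k then r else 0) + coef xs k"
  "coef (xs @ ys) k = coef xs k + coef ys k"
  by (simp_all add: coef_def)

lemma coef_filter: "coef (filter (\<lambda>(r, k). P k) xs) k = (if P k then coef xs k else 0)"
  by (induction xs) auto

lemma coef_uminus:
  fixes xs :: "('r::ab_group_add \<times> 'k) list"
  shows "coef (map (\<lambda>(r, k). (- r, k)) xs) k = - coef xs k"
  by (induction xs) auto

lemma coef_nonzero_imp_key: "coef xs k \<noteq> 0 \<Longrightarrow> k \<in> snd ` set xs"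
  by (induction xs) (auto split: if_splits)

lemma coef_map_distinct:
  "distinct ks \<Longrightarrow> coef (map (\<lambda>k. (f k, k)) ks) k = (if k \<in> set ks then f k else 0)"
  by (induction ks) auto

locale assoc_algebra = nonassoc_algebra A
  for A :: "('r::{comm_ring, comm_monoid_mult}, 'a) algebra" +
  assumes mult_assoc: "\<lbrakk>a \<in> acarrier A; b \<in> acarrier A; c \<in> acarrier A\<rbrakk> \<Longrightarrow>
      amult A (amult A a b) c = amult A a (amult A b c)"
begin

section \<open>Zero laws and cancellation\<close>

lemmas closed [simp] = zero_closed add_closed mult_closed scale_closed

lemma add_zero_right: "a \<in> acarrier A \<Longrightarrow> aadd A a (azero A) = a"
  using add_zero add_commute zero_closed by metis

lemma add_left_commute:
  "\<lbrakk>a \<in> acarrier A; b \<in> acarrier A; c \<in> acarrier A\<rbrakk> \<Longrightarrow>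
    aadd A a (aadd A b c) = aadd A b (aadd A a c)"
  using add_assoc add_commute by metis

text \<open>The source of the zero laws below: by distributivity each product or scalar multiple in
  question equals its own double.\<close>

lemma idem_add_eq_zero:
  assumes "a \<in> acarrier A" and "aadd A a a = a"
  shows "a = azero A"
proof -
  obtain b where b: "b \<in> acarrier A" "aadd A a b = azero A"
    using add_inverse assms(1) by blast
  then have "aadd A (aadd A a a) b = aadd A a (azero A)"
    using assms(1) by (simp add: add_assoc)
  then show ?thesis
    using assms b by (simp add: add_zero_right)
qed

lemma scale_zero_left [simp]: "a \<in> acarrier A \<Longrightarrow> ascale A 0 a = azero A"
  using scale_add_left[of a 0 0] by (intro idem_add_eq_zero) simp_all

lemma scale_zero_right [simp]: "ascale A r (azero A) = azero A"
  using scale_add_right[of "azero A" "azero A" r] by (intro idem_add_eq_zero) (simp_all add: add_zero)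

lemma mult_zero_left [simp]: "a \<in> acarrier A \<Longrightarrow> amult A (azero A) a = azero A"
  using mult_add_left[of "azero A" "azero A" a] by (intro idem_add_eq_zero) (simp_all add: add_zero)

lemma mult_zero_right [simp]: "a \<in> acarrier A \<Longrightarrow> amult A a (azero A) = azero A"
  using mult_add_right[of a "azero A" "azero A"] by (intro idem_add_eq_zero) (simp_all add: add_zero)

lemma add_scale_minus_one: "a \<in> acarrier A \<Longrightarrow> aadd A a (ascale A (- 1) a) = azero A"
  using scale_add_left[of a 1 "- 1"] by (simp add: scale_one)

lemma eq_if_diff_zero:
  assumes "a \<in> acarrier A" "b \<in> acarrier A" "aadd A a (ascale A (- 1) b) = azero A"
  shows "a = b"
proof -
  have "aadd A (aadd A a (ascale A (- 1) b)) b = aadd A a (aadd A b (ascale A (- 1) b))"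
    using assms(1,2) add_commute[of "ascale A (- 1) b" b] by (simp add: add_assoc)
  then show ?thesis
    using assms by (simp add: add_scale_minus_one add_zero add_zero_right)
qed

section \<open>Linear combinations given by lists\<close>

definition lin_comb :: "('k \<Rightarrow> 'a) \<Rightarrow> ('r \<times> 'k) list \<Rightarrow> 'a" where
  "lin_comb b xs = foldr (\<lambda>(r, k). aadd A (ascale A r (b k))) xs (azero A)"

lemma lin_comb_simps [simp]:
  "lin_comb b [] = azero A"
  "lin_comb b ((r, k) # xs) = aadd A (ascale A r (b k)) (lin_comb b xs)"
  by (simp_all add: lin_comb_def)

lemma lin_comb_closed [simp]:
  "b ` snd ` set xs \<subseteq> acarrier A \<Longrightarrow> lin_comb b xs \<in> acarrier A"
  by (induction xs) auto

lemma lin_comb_append: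
  "\<lbrakk>b ` snd ` set xs \<subseteq> acarrier A; b ` snd ` set ys \<subseteq> acarrier A\<rbrakk> \<Longrightarrow>
    lin_comb b (xs @ ys) = aadd A (lin_comb b xs) (lin_comb b ys)"
  by (induction xs) (auto simp: add_zero add_assoc)

lemma lin_comb_scale:
  "b ` snd ` set xs \<subseteq> acarrier A \<Longrightarrow>
    lin_comb b (map (\<lambda>(s, k). (r * s, k)) xs) = ascale A r (lin_comb b xs)"
  by (induction xs) (auto simp: scale_add_right scale_scale)

lemma lin_comb_filter:
  "b ` snd ` set xs \<subseteq> acarrier A \<Longrightarrow>
    lin_comb b xs = aadd A (lin_comb b (filter (\<lambda>(r, k). P k) xs))
      (lin_comb b (filter (\<lambda>(r, k). \<not> P k) xs))"
proof (induction xs)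
  case (Cons x xs)
  obtain r k where x: "x = (r, k)" by force
  have "lin_comb b (filter Q xs) \<in> acarrier A" for Q
    using Cons.prems by (intro lin_comb_closed) auto
  then show ?case
    using Cons by (auto simp: x add_assoc add_left_commute)
qed (simp add: add_zero)

lemma lin_comb_single_key:
  "b k \<in> acarrier A \<Longrightarrow>
    lin_comb b (filter (\<lambda>(r, k'). k' = k) xs) = ascale A (coef xs k) (b k)"
  by (induction xs) (auto simp: scale_add_left)

text \<open>Induction on the length: all entries sharing the first key are removed at once. Together
  they contribute the total coefficient of that key, which is zero, and the shorter list still has
  only zero coefficients.\<close>

lemma lin_comb_eq_zero:
  assumes "b ` snd ` set xs \<subseteq> acarrier A" and "\<And>k. coef xs k = 0"
  shows "lin_comb b xs = azero A"
  using assms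
proof (induction xs rule: length_induct)
  case (1 xs)
  show ?case
  proof (cases xs)
    case (Cons x xs')
    obtain r k where x: "x = (r, k)" by force
    let ?ys = "filter (\<lambda>(r, k'). k' \<noteq> k) xs"
    have bk: "b k \<in> acarrier A"
      using "1.prems"(1) by (auto simp: Cons x)
    have "length ?ys < length xs"
      by (simp add: Cons x less_Suc_eq_le)
    moreover have "b ` snd ` set ?ys \<subseteq> acarrier A"
      using "1.prems"(1) by auto
    moreover have "coef ?ys k' = 0" for k'
      using coef_filter[of "\<lambda>k'. k' \<noteq> k" xs k'] "1.prems"(2) by simp
    ultimately have "lin_comb b ?ys = azero A"
      using "1.IH" by blast
    then show ?thesis
      using lin_comb_filter[OF "1.prems"(1), of "\<lambda>k'. k' = k"] "1.prems"(2) bk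
      by (simp add: lin_comb_single_key add_zero)
  qed simp
qed

text \<open>Apply \<open>lin_comb_eq_zero\<close> to \<open>xs\<close> followed by the negative of
  \<open>ys\<close>.\<close>

lemma lin_comb_eqI:
  assumes "b ` snd ` set xs \<subseteq> acarrier A" "b ` snd ` set ys \<subseteq> acarrier A"
    and "\<And>k. coef xs k = coef ys k"
  shows "lin_comb b xs = lin_comb b ys"
proof (rule eq_if_diff_zero)
  let ?zs = "map (\<lambda>(s, k). (- 1 * s, k)) ys"
  have zs: "b ` snd ` set ?zs \<subseteq> acarrier A"
    using assms(2) by force
  have "lin_comb b (xs @ ?zs) = azero A"
  proof (rule lin_comb_eq_zero)
    show "b ` snd ` set (xs @ ?zs) \<subseteq> acarrier A"
      using assms(1) zs by (simp add: image_Un)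
    show "coef (xs @ ?zs) k = 0" for k
      using assms(3) coef_uminus[of ys k] by simp
  qed
  then show "aadd A (lin_comb b xs) (ascale A (- 1) (lin_comb b ys)) = azero A"
    using lin_comb_append[OF assms(1) zs] lin_comb_scale[OF assms(2), of "- 1"] by simp
qed (use assms in simp_all)

section \<open>Spans\<close>

definition span :: "('k \<Rightarrow> 'a) \<Rightarrow> 'k set \<Rightarrow> 'a set" where
  "span b K = {lin_comb b xs | xs. snd ` set xs \<subseteq> K}"

lemma span_zero [simp]: "azero A \<in> span b K"
  by (auto simp: span_def intro!: exI[of _ "[]"])

lemma span_base: "\<lbrakk>k \<in> K; b k \<in> acarrier A\<rbrakk> \<Longrightarrow> b k \<in> span b K"
  by (auto simp: span_def scale_one add_zero_right intro!: exI[of _ "[(1, k)]"])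

lemma span_add:
  assumes "b ` K \<subseteq> acarrier A" "x \<in> span b K" "y \<in> span b K"
  shows "aadd A x y \<in> span b K"
proof -
  obtain xs ys where "x = lin_comb b xs" "snd ` set xs \<subseteq> K" "y = lin_comb b ys" "snd ` set ys \<subseteq> K"
    using assms by (auto simp: span_def)
  moreover from this have "b ` snd ` set xs \<subseteq> acarrier A" "b ` snd ` set ys \<subseteq> acarrier A"
    using assms(1) by blast+
  ultimately have "aadd A x y = lin_comb b (xs @ ys)" "snd ` set (xs @ ys) \<subseteq> K"
    by (simp_all only: lin_comb_append set_append image_Un Un_subset_iff)
  then show ?thesis
    by (auto simp only: span_def)
qed

lemma span_scale:
  assumes "b ` K \<subseteq> acarrier A" "x \<in> span b K"
  shows "ascale A r x \<in> span b K"
proof -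
  obtain xs where xs: "x = lin_comb b xs" "snd ` set xs \<subseteq> K"
    using assms by (auto simp: span_def)
  moreover from this have "b ` snd ` set xs \<subseteq> acarrier A"
    using assms(1) by blast
  moreover have "snd ` set (map (\<lambda>(s, k). (r * s, k)) xs) \<subseteq> K"
    using xs(2) by force
  ultimately show ?thesis
    unfolding span_def xs(1) by (metis (mono_tags, lifting) lin_comb_scale mem_Collect_eq)
qed

lemma span_closed: "\<lbrakk>b ` K \<subseteq> acarrier A; x \<in> span b K\<rbrakk> \<Longrightarrow> x \<in> acarrier A"
  unfolding span_def by (auto intro!: lin_comb_closed)

text \<open>Bilinearity reduces the claim to products of two base elements: \<open>left\<close>
  expands the right factor, a second induction the left one.\<close>

lemma span_mult:
  assumes bK: "b ` K \<subseteq> acarrier A"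
    and base: "\<And>k l. \<lbrakk>k \<in> K; l \<in> K\<rbrakk> \<Longrightarrow> amult A (b k) (b l) \<in> span b K"
    and x: "x \<in> span b K" and y: "y \<in> span b K"
  shows "amult A x y \<in> span b K"
proof -
  have left: "amult A (b k) (lin_comb b ys) \<in> span b K" if "k \<in> K" "snd ` set ys \<subseteq> K" for k ys
    using that(2)
  proof (induction ys)
    case (Cons z ys)
    obtain s l where z: "z = (s, l)" by force
    have car: "b k \<in> acarrier A" "b l \<in> acarrier A" "lin_comb b ys \<in> acarrier A"
      using bK that(1) Cons.prems z by (auto intro!: lin_comb_closed)
    have "aadd A (ascale A s (amult A (b k) (b l))) (amult A (b k) (lin_comb b ys)) \<in> span b K"
      using Cons that(1) bK z by (intro span_add span_scale base) auto
    then show ?case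
      using car by (simp add: z mult_add_right mult_scale_right)
  qed (use bK that in auto)
  obtain ys where ys: "y = lin_comb b ys" "snd ` set ys \<subseteq> K"
    using y by (auto simp: span_def)
  have "amult A (lin_comb b xs) y \<in> span b K" if "snd ` set xs \<subseteq> K" for xs
    using that
  proof (induction xs)
    case (Cons z xs)
    obtain s l where z: "z = (s, l)" by force
    have car: "y \<in> acarrier A" "b l \<in> acarrier A" "lin_comb b xs \<in> acarrier A"
      using bK span_closed[OF bK y] Cons.prems z by (auto intro!: lin_comb_closed)
    have "aadd A (ascale A s (amult A (b l) y)) (amult A (lin_comb b xs) y) \<in> span b K"
      using Cons bK z ys left by (intro span_add span_scale) auto
    then show ?case
      using car by (simp add: z mult_add_left mult_scale_left)
  qed (use span_closed[OF bK y] in auto)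
  with x show ?thesis
    by (auto simp: span_def)
qed

section \<open>Integer powers in a corner of the algebra\<close>

definition zpow :: "'a \<Rightarrow> 'a \<Rightarrow> 'a \<Rightarrow> int \<Rightarrow> 'a" where
  "zpow u x y n = (if n \<ge> 0 then (amult A x ^^ nat n) u else (amult A y ^^ nat (- n)) u)"

end

text \<open>Here \<open>x\<close> and \<open>y\<close> are inverse to each other in the corner cut
  out by the idempotent \<open>u\<close>. Since \<open>u\<close> need not be a unit of the whole
  algebra, \<open>zpow\<close> starts its iteration from \<open>u\<close>.\<close>

locale unit_pair = assoc_algebra +
  fixes u x y
  assumes u_closed [simp]: "u \<in> acarrier A" and x_closed [simp]: "x \<in> acarrier A"
    and y_closed [simp]: "y \<in> acarrier A"
    and uu [simp]: "amult A u u = u" and ux [simp]: "amult A u x = x" and uy [simp]: "amult A u y = y"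
    and xy [simp]: "amult A x y = u" and yx [simp]: "amult A y x = u"
begin

lemma zpow_0 [simp]: "zpow u x y 0 = u"
  by (simp add: zpow_def)

lemma zpow_closed [simp]: "zpow u x y n \<in> acarrier A"
proof -
  have "(amult A x ^^ m) u \<in> acarrier A" "(amult A y ^^ m) u \<in> acarrier A" for m
    by (induction m) auto
  then show ?thesis
    by (simp add: zpow_def)
qed

lemma unit_mult_zpow [simp]: "amult A u (zpow u x y n) = zpow u x y n"
proof -
  have car: "(amult A x ^^ m) u \<in> acarrier A" "(amult A y ^^ m) u \<in> acarrier A" for m
    by (induction m) auto
  have "amult A u ((amult A x ^^ m) u) = (amult A x ^^ m) u"
    "amult A u ((amult A y ^^ m) u) = (amult A y ^^ m) u" for m
    using car by (induction m) (auto simp: mult_assoc[symmetric])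
  then show ?thesis
    by (simp add: zpow_def)
qed

text \<open>Bracket \<open>x y x\<close> and \<open>y x y\<close> in the two possible ways.\<close>

lemma xu [simp]: "amult A x u = x" and yu [simp]: "amult A y u = y"
proof -
  have "amult A x (amult A y x) = x" "amult A y (amult A x y) = y"
    using mult_assoc[of x y x] mult_assoc[of y x y] by simp_all
  then show "amult A x u = x" "amult A y u = y" by simp_all
qed

lemma zpow_one [simp]: "zpow u x y 1 = x" and zpow_minus_one [simp]: "zpow u x y (- 1) = y"
  by (simp_all add: zpow_def)

lemma zpow_add_one: "zpow u x y (n + 1) = amult A x (zpow u x y n)"
proof (cases "n \<ge> 0")
  case True
  then have "nat (n + 1) = Suc (nat n)" by simp
  with True show ?thesis by (simp add: zpow_def)
next
  case False
  define m where "m = nat (- n - 1)"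
  have n: "n = - 1 - int m" using False by (simp add: m_def)
  have "amult A x (amult A y (zpow u x y (- int m))) = zpow u x y (- int m)"
    by (simp flip: mult_assoc)
  \<comment> \<open>For \<open>m = 0\<close> the exponent \<open>- int m\<close> falls into the
    nonnegative branch of \<open>zpow\<close>; both branches give \<open>u\<close> there.\<close>
  moreover have "zpow u x y n = amult A y (zpow u x y (- int m))"
  proof -
    have "nat (int m + 1) = Suc m" by simp
    then show ?thesis by (simp add: zpow_def n)
  qed
  ultimately show ?thesis by (simp add: n)
qed

lemma zpow_diff_one: "zpow u x y (n - 1) = amult A y (zpow u x y n)"
  using zpow_add_one[of "n - 1"] by (simp flip: mult_assoc)

lemma zpow_add: "amult A (zpow u x y m) (zpow u x y n) = zpow u x y (m + n)"
proof (induction m rule: int_induct[where k = 0])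
  case (step1 i)
  then show ?case
    using zpow_add_one[of i] zpow_add_one[of "i + n"] by (simp add: mult_assoc add_ac)
next
  case (step2 i)
  then show ?case
    using zpow_diff_one[of i] zpow_diff_one[of "i + n"] by (simp add: mult_assoc algebra_simps)
qed simp

end

section \<open>Leavitt families in dextral symmetric algebras\<close>

text \<open>The analysis of the edges needs only elements that satisfy the relations, so it is
  carried out in any associative dextral symmetric algebra; \<open>y e\<close> stands for the ghost
  edge. It is applied later to the classes of the generators.\<close>

locale leavitt_family = assoc_algebra A + wf_digraph E
  for A :: "('r::{comm_ring, comm_monoid_mult}, 'a) algebra" and E :: "('v, 'e) pre_digraph" +
  fixes p :: "'v \<Rightarrow> 'a" and x y :: "'e \<Rightarrow> 'a"
  assumes dextral: "dextral_symmetric A"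
    and p_closed [simp]: "v \<in> verts E \<Longrightarrow> p v \<in> acarrier A"
    and x_closed [simp]: "e \<in> arcs E \<Longrightarrow> x e \<in> acarrier A"
    and y_closed [simp]: "e \<in> arcs E \<Longrightarrow> y e \<in> acarrier A"
    and idempotent [simp]: "v \<in> verts E \<Longrightarrow> amult A (p v) (p v) = p v"
    and orthogonal: "\<lbrakk>v \<in> verts E; w \<in> verts E; v \<noteq> w\<rbrakk> \<Longrightarrow> amult A (p v) (p w) = azero A"
    and source_edge: "e \<in> arcs E \<Longrightarrow> amult A (p (tail E e)) (x e) = x e"
    and edge_range: "e \<in> arcs E \<Longrightarrow> amult A (x e) (p (head E e)) = x e"
    and range_ghost: "e \<in> arcs E \<Longrightarrow> amult A (p (head E e)) (y e) = y e"
    and ghost_source: "e \<in> arcs E \<Longrightarrow> amult A (y e) (p (tail E e)) = y e"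
    and ghost_edge: "e \<in> arcs E \<Longrightarrow> amult A (y e) (x e) = p (head E e)"
    and ghost_edge_neq: "\<lbrakk>e \<in> arcs E; f \<in> arcs E; e \<noteq> f\<rbrakk> \<Longrightarrow> amult A (y e) (x f) = azero A"
    and regular: "\<lbrakk>regular_vertex E v; distinct es; set es = out_arcs E v\<rbrakk> \<Longrightarrow>
      p v = foldr (\<lambda>e. aadd A (amult A (x e) (y e))) es (azero A)"
begin

lemma dextral_rule:
  "\<lbrakk>amult A a (amult A b c) = azero A; a \<in> acarrier A; b \<in> acarrier A; c \<in> acarrier A\<rbrakk> \<Longrightarrow>
    amult A b (amult A a c) = azero A"
  using dextral by (simp add: dextral_symmetric_def)

section \<open>Live edges\<close>

definition live :: "'e \<Rightarrow> bool" where
  "live e \<longleftrightarrow> e \<in> arcs E \<and> p (head E e) \<noteq> azero A"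

lemma live_arc [simp]: "live e \<Longrightarrow> e \<in> arcs E"
  by (simp add: live_def)

lemma not_live_zero:
  assumes "e \<in> arcs E" "\<not> live e"
  shows "x e = azero A" and "y e = azero A"
  using edge_range[OF assms(1)] range_ghost[OF assms(1)] assms
  by (metis live_def mult_zero_left mult_zero_right x_closed y_closed)+

text \<open>If the range \<open>r\<close> of \<open>e\<close> differs from its source, orthogonality
  gives \<open>r e = 0\<close>, hence \<open>r (e r) = 0\<close>. Dextral symmetry swaps the first
  two factors, so \<open>e = e (r r) = 0\<close>; then \<open>r\<close>, the product of ghost edge
  and edge, is zero.\<close>

lemma live_loop:
  assumes "live e"
  shows "head E e = tail E e"
proof (rule ccontr)
  assume neq: "head E e \<noteq> tail E e"
  have e: "e \<in> arcs E"
    using assms by simp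
  let ?r = "p (head E e)"
  have "amult A ?r (x e) = amult A ?r (amult A (p (tail E e)) (x e))"
    by (simp add: source_edge e)
  also have "\<dots> = azero A"
    using neq e by (simp add: orthogonal flip: mult_assoc)
  finally have "amult A ?r (amult A (x e) ?r) = azero A"
    using e by (simp add: edge_range)
  then have "amult A (x e) (amult A ?r ?r) = azero A"
    using e by (elim dextral_rule) simp_all
  then have "x e = azero A"
    using e by (simp add: edge_range)
  then have "?r = azero A"
    using ghost_edge[OF e] e by simp
  then show False
    using assms by (simp add: live_def)
qed

text \<open>The defect \<open>d = v - ee\<^sup>*\<close> satisfies \<open>de = 0\<close>, hence \<open>ed = 0\<close> and \<open>d = e\<^sup>*ed = 0\<close>.\<close>

lemma live_edge_ghost:
  assumes "live e"
  shows "amult A (x e) (y e) = p (tail E e)"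
proof -
  have e: "e \<in> arcs E"
    using assms by simp
  have loop: "head E e = tail E e"
    using assms by (rule live_loop)
  let ?v = "p (tail E e)"
  define d where "d = aadd A ?v (ascale A (- 1) (amult A (x e) (y e)))"
  have d: "d \<in> acarrier A"
    using e by (simp add: d_def)
  have vd: "amult A ?v d = d"
    using e by (simp add: d_def mult_add_right mult_scale_right source_edge flip: mult_assoc)
  have dv: "amult A d ?v = d"
    using e by (simp add: d_def mult_add_left mult_scale_left ghost_source mult_assoc)
  have ev: "amult A (x e) ?v = x e" "amult A (y e) (x e) = ?v"
    using edge_range[OF e] ghost_edge[OF e] loop by simp_all
  have "amult A d (x e) = azero A"
    using e by (simp add: d_def mult_add_left mult_scale_left mult_assoc ev source_edge
        add_scale_minus_one)
  then have "amult A d (amult A (x e) ?v) = azero A"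
    by (simp add: ev)
  then have "amult A (x e) (amult A d ?v) = azero A"
    using e d by (elim dextral_rule) simp_all
  then have "amult A (y e) (amult A (x e) d) = azero A"
    using e by (simp add: dv)
  then have "d = azero A"
    using e d by (simp add: ev vd flip: mult_assoc)
  then show ?thesis
    using eq_if_diff_zero[of ?v "amult A (x e) (y e)"] e by (simp add: d_def)
qed

text \<open>By \<open>live_edge_ghost\<close> the common source equals the product of
  \<open>x e\<close> and \<open>y e\<close>. If the edges were distinct, \<open>y e\<close> would
  annihilate \<open>x f\<close>, so \<open>x f\<close> and with it the range of \<open>f\<close>
  would be zero.\<close>

lemma live_unique:
  assumes "live e" "live f" "tail E e = tail E f"
  shows "e = f"
proof (rule ccontr)
  assume "e \<noteq> f"
  have ef: "e \<in> arcs E" "f \<in> arcs E"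
    using assms by simp_all
  have "x f = amult A (amult A (x e) (y e)) (x f)"
    using source_edge[OF ef(2)] by (simp add: live_edge_ghost assms)
  also have "\<dots> = azero A"
    using ef \<open>e \<noteq> f\<close> by (simp add: mult_assoc ghost_edge_neq)
  finally have "p (head E f) = azero A"
    using ghost_edge[OF ef(2)] ef by simp
  then show False
    using assms(2) by (simp add: live_def)
qed

section \<open>Vertices with a live loop\<close>

definition has_loop :: "'v \<Rightarrow> bool" where
  "has_loop v \<longleftrightarrow> (\<exists>e. live e \<and> tail E e = v)"

lemma has_loopD: "has_loop v \<Longrightarrow> v \<in> verts E \<and> p v \<noteq> azero A"
  unfolding has_loop_def by (metis live_def live_loop tail_in_verts)

text \<open>If all edges at \<open>v\<close> were dead, every summand of the regular relation would
  vanish, and \<open>p v\<close> with them.\<close>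

lemma regular_has_loop:
  assumes "regular_vertex E v" "p v \<noteq> azero A"
  shows "has_loop v"
proof (rule ccontr)
  assume no: "\<not> has_loop v"
  obtain es where es: "set es = out_arcs E v" "distinct es"
    using assms(1) finite_distinct_list by (auto simp: regular_vertex_def)
  have dead: "\<not> live e" if "e \<in> out_arcs E v" for e
    using no that by (auto simp: has_loop_def)
  have "foldr (\<lambda>e. aadd A (amult A (x e) (y e))) es' (azero A) = azero A"
    if "set es' \<subseteq> out_arcs E v" for es'
    using that by (induction es') (simp_all add: not_live_zero(1) dead add_zero)
  then show False
    using regular[OF assms(1) es(2,1)] assms(2) es(1) by simp
qed

text \<open>Without a live edge at \<open>v\<close>, the value \<open>p v\<close> makes \<open>loop_x v\<close> and \<open>loop_y v\<close> inverse to each other.\<close>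

definition loop_x :: "'v \<Rightarrow> 'a" where
  "loop_x v = (if has_loop v then x (SOME e. live e \<and> tail E e = v) else p v)"

definition loop_y :: "'v \<Rightarrow> 'a" where
  "loop_y v = (if has_loop v then y (SOME e. live e \<and> tail E e = v) else p v)"

text \<open>By \<open>live_unique\<close> only one edge qualifies, so the choice in
  \<open>loop_x\<close> and \<open>loop_y\<close> returns it.\<close>

lemma loop_live: "live e \<Longrightarrow> loop_x (tail E e) = x e \<and> loop_y (tail E e) = y e"
proof -
  assume e: "live e"
  have "(SOME f. live f \<and> tail E f = tail E e) = e"
    using e live_unique by (intro some_equality) auto
  then show ?thesis
    using e by (auto simp: loop_x_def loop_y_def has_loop_def)
qed

lemma unit_pair_loop:
  assumes "v \<in> verts E"
  shows "unit_pair A (p v) (loop_x v) (loop_y v)"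
proof (cases "has_loop v")
  case True
  then obtain e where e: "live e" "tail E e = v"
    by (auto simp: has_loop_def)
  then have arc: "e \<in> arcs E" and loop: "head E e = v"
    using live_loop by auto
  show ?thesis
    using loop_live[OF e(1)] e arc loop source_edge[OF arc] range_ghost[OF arc] ghost_edge[OF arc]
      live_edge_ghost[OF e(1)] assms
    by unfold_locales auto
next
  case False
  then show ?thesis
    using assms by unfold_locales (auto simp: loop_x_def loop_y_def)
qed

text \<open>At a vertex without a live loop all powers equal \<open>p v\<close>, and a zero vertex
  yields only zero. Either would spoil independence, so the first kind keeps only exponent 0 and the
  second no index at all.\<close>

definition mono_index :: "('v \<times> int) set" where
  "mono_index = {(v, n). v \<in> verts E \<and> p v \<noteq> azero A \<and> (n = 0 \<or> has_loop v)}"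

definition mono_val :: "'v \<times> int \<Rightarrow> 'a" where
  "mono_val = (\<lambda>(v, n). zpow (p v) (loop_x v) (loop_y v) n)"

lemma mono_val_closed: "mono_val ` mono_index \<subseteq> acarrier A"
  by (auto simp: mono_val_def mono_index_def unit_pair.zpow_closed[OF unit_pair_loop])

lemma mono_val_mult:
  assumes "k \<in> mono_index" "l \<in> mono_index"
  shows "amult A (mono_val k) (mono_val l) \<in> span mono_val mono_index"
proof -
  obtain v m w n where kl: "k = (v, m)" "l = (w, n)" by force
  have vw: "v \<in> verts E" "w \<in> verts E"
    using assms by (auto simp: kl mono_index_def)
  interpret v: unit_pair A "p v" "loop_x v" "loop_y v" by (rule unit_pair_loop[OF vw(1)])
  interpret w: unit_pair A "p w" "loop_x w" "loop_y w" by (rule unit_pair_loop[OF vw(2)])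
  let ?a = "zpow (p v) (loop_x v) (loop_y v) m" and ?b = "zpow (p w) (loop_x w) (loop_y w) n"
  show ?thesis
  proof (cases "v = w")
    case True
    \<comment> \<open>Without a live loop at \<open>v\<close> both exponents are 0, and so is their
      sum.\<close>
    then have "(v, m + n) \<in> mono_index"
      using assms by (auto simp: kl mono_index_def)
    then have "mono_val (v, m + n) \<in> span mono_val mono_index"
      using mono_val_closed by (intro span_base) auto
    then show ?thesis
      using True v.zpow_add by (simp add: kl mono_val_def)
  next
    case False
    \<comment> \<open>\<open>zpow_add\<close> with second exponent 0 inserts \<open>p v\<close> to
      the right of the first factor, where it meets the orthogonal \<open>p w\<close>.\<close>
    have "amult A ?a ?b = amult A (amult A ?a (p v)) (amult A (p w) ?b)"
      using v.zpow_add[of m 0] by simp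
    also have "\<dots> = amult A ?a (amult A (amult A (p v) (p w)) ?b)"
      by (simp add: mult_assoc del: w.unit_mult_zpow)
    also have "\<dots> = azero A"
      using False vw by (simp add: orthogonal)
    finally show ?thesis
      by (simp add: kl mono_val_def)
  qed
qed

lemma p_in_span: "v \<in> verts E \<Longrightarrow> p v \<in> span mono_val mono_index"
proof (cases "p v = azero A")
  case False
  assume v: "v \<in> verts E"
  then have "mono_val (v, 0) \<in> span mono_val mono_index"
    using False by (intro span_base) (auto simp: mono_index_def mono_val_def zpow_def)
  then show ?thesis
    by (simp add: mono_val_def zpow_def)
qed simp

lemma xy_in_span:
  assumes e: "e \<in> arcs E"
  shows "x e \<in> span mono_val mono_index" and "y e \<in> span mono_val mono_index"
proof -
  have "x e \<in> span mono_val mono_index \<and> y e \<in> span mono_val mono_index"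
  proof (cases "live e")
    case True
    interpret u: unit_pair A "p (tail E e)" "loop_x (tail E e)" "loop_y (tail E e)"
      using e by (intro unit_pair_loop) simp
    have "has_loop (tail E e)"
      using True by (auto simp: has_loop_def)
    then have "(tail E e, n) \<in> mono_index" for n
      using has_loopD by (auto simp: mono_index_def)
    then have "mono_val (tail E e, n) \<in> span mono_val mono_index" for n
      using mono_val_closed by (intro span_base) auto
    from this[of 1] this[of "- 1"] have "loop_x (tail E e) \<in> span mono_val mono_index"
      "loop_y (tail E e) \<in> span mono_val mono_index"
      by (simp_all add: mono_val_def)
    then show ?thesis
      by (simp add: loop_live[OF True])
  qed (use e not_live_zero in simp)
  then show "x e \<in> span mono_val mono_index" and "y e \<in> span mono_val mono_index"
    by auto
qed

end

section \<open>Evaluation of expressions in a ring\<close>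

text \<open>The scalar action is a parameter; its laws are assumed only in
  \<open>eval_cong\<close>.\<close>

primrec eval :: "('g \<Rightarrow> 'a::ring) \<Rightarrow> ('r \<Rightarrow> 'a \<Rightarrow> 'a) \<Rightarrow> ('r, 'g) expr \<Rightarrow> 'a" where
  "eval g sc (Gen a) = g a"
| "eval g sc Zero = 0"
| "eval g sc (Neg s) = - eval g sc s"
| "eval g sc (Add s t) = eval g sc s + eval g sc t"
| "eval g sc (Mult s t) = eval g sc s * eval g sc t"
| "eval g sc (Scale r s) = sc r (eval g sc s)"

text \<open>The universal property of the presentation: it allows maps out of the quotient to be
  defined by values on the generators.\<close>

lemma eval_cong:
  assumes "(s, t) \<in> presented_cong X rel"
    and sc: "\<And>r a b. sc r (a + b) = sc r a + sc r b" "\<And>r r' a. sc (r + r') a = sc r a + sc r' a"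
      "\<And>r r' a. sc r (sc r' a) = sc (r * r') a" "\<And>a. sc 1 a = a"
      "\<And>r a b. sc r a * b = sc r (a * b)" "\<And>r a b. a * sc r b = sc r (a * b)"
    and rel: "\<And>s t. rel s t \<Longrightarrow> eval g sc s = eval g sc t"
  shows "eval g sc s = eval g sc t"
  using assms(1)
proof induction
  case (axiom s t)
  from axiom(1) show ?case
    by cases (simp_all add: sc algebra_simps)
qed (auto simp: rel)

abbreviation scale_poly :: "'r::{comm_ring, comm_monoid_mult} \<Rightarrow> (int \<Rightarrow>\<^sub>0 'r) \<Rightarrow> (int \<Rightarrow>\<^sub>0 'r)" where
  "scale_poly r \<equiv> Poly_Mapping.map ((*) r)"

lemma lookup_scale_poly [simp]: "Poly_Mapping.lookup (scale_poly r f) n = r * Poly_Mapping.lookup f n"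
  by (simp add: Poly_Mapping.map.rep_eq when_def)

lemma scale_poly_simps:
  fixes f g :: "int \<Rightarrow>\<^sub>0 'r::{comm_ring, comm_monoid_mult}"
  shows "scale_poly r (f + g) = scale_poly r f + scale_poly r g"
    and "scale_poly (r + s) f = scale_poly r f + scale_poly s f"
    and "scale_poly r (scale_poly s f) = scale_poly (r * s) f"
    and "scale_poly 1 f = f"
    and "scale_poly r f * g = scale_poly r (f * g)"
    and "f * scale_poly r g = scale_poly r (f * g)"
proof -
  show "scale_poly r (f + g) = scale_poly r f + scale_poly r g"
    "scale_poly (r + s) f = scale_poly r f + scale_poly s f"
    "scale_poly r (scale_poly s f) = scale_poly (r * s) f" "scale_poly 1 f = f"
    by (auto intro!: poly_mapping_eqI simp: lookup_add algebra_simps)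
  \<comment> \<open>Scaling by \<open>r\<close> is multiplication by the constant \<open>r\<close>,
    so both laws come from associativity and commutativity.\<close>
  show "scale_poly r f * g = scale_poly r (f * g)" "f * scale_poly r g = scale_poly r (f * g)"
    by (simp_all add: mult_map_scale_conv_mult mult.assoc mult.left_commute)
qed

section \<open>The isomorphism\<close>

locale dextral_leavitt = wf_digraph E for E :: "('v, 'e) pre_digraph" +
  fixes T :: "'r::{comm_ring, comm_monoid_mult} itself"
  assumes dextral_leavitt: "dextral_symmetric (leavitt_path_algebra T E)"
begin

section \<open>Classes of expressions\<close>

abbreviation L :: "('r, ('r, ('v, 'e) lpa_gen) expr set) algebra" where
  "L \<equiv> leavitt_path_algebra T E"

abbreviation X :: "('r, ('v, 'e) lpa_gen) expr set" where
  "X \<equiv> exprs (lpa_gens E)"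

definition cls :: "('r, ('v, 'e) lpa_gen) expr \<Rightarrow> ('r, ('v, 'e) lpa_gen) expr set" where
  "cls s = presented_cong (lpa_gens E) (lpa_rel E) `` {s}"

lemma cls_simps [simp]:
  "azero L = cls Zero"
  "\<lbrakk>s \<in> X; t \<in> X\<rbrakk> \<Longrightarrow> aadd L (cls s) (cls t) = cls (Add s t)"
  "\<lbrakk>s \<in> X; t \<in> X\<rbrakk> \<Longrightarrow> amult L (cls s) (cls t) = cls (Mult s t)"
  "s \<in> X \<Longrightarrow> ascale L r (cls s) = cls (Scale r s)"
  by (simp_all add: cls_def leavitt_path_algebra_def presented_algebra_simps)

lemma carrier_L: "acarrier L = cls ` X"
  by (auto simp: cls_def leavitt_path_algebra_def presented_algebra_simps quotient_def)

lemma cls_eq_iff: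
  "\<lbrakk>s \<in> X; t \<in> X\<rbrakk> \<Longrightarrow> cls s = cls t \<longleftrightarrow> (s, t) \<in> presented_cong (lpa_gens E) (lpa_rel E)"
  unfolding cls_def by (rule eq_equiv_class_iff[OF equiv_presented_cong])

lemma cls_rel: "\<lbrakk>lpa_rel E s t; s \<in> X; t \<in> X\<rbrakk> \<Longrightarrow> cls s = cls t"
  by (simp add: cls_eq_iff presented_cong.relation)

lemma gens_simps [simp]:
  "Vertex v \<in> lpa_gens E \<longleftrightarrow> v \<in> verts E"
  "Edge e \<in> lpa_gens E \<longleftrightarrow> e \<in> arcs E"
  "Ghost e \<in> lpa_gens E \<longleftrightarrow> e \<in> arcs E"
  by (auto simp: lpa_gens_def)

lemma foldr_exprs:
  "set es \<subseteq> arcs E \<Longrightarrow> foldr (\<lambda>e. Add (Mult (edg e) (gho e))) es Zero \<in> X"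
  by (induction es) auto

lemma cls_foldr:
  "set es \<subseteq> arcs E \<Longrightarrow> cls (foldr (\<lambda>e. Add (Mult (edg e) (gho e))) es Zero) =
    foldr (\<lambda>e. aadd L (amult L (cls (edg e)) (cls (gho e)))) es (azero L)"
proof (induction es)
  case (Cons e es)
  then have "foldr (\<lambda>e. aadd L (amult L (cls (edg e)) (cls (gho e)))) es (azero L) =
      cls (foldr (\<lambda>e. Add (Mult (edg e) (gho e))) es Zero)"
    by simp
  then show ?case
    using Cons.prems foldr_exprs[of es] by simp
qed simp

text \<open>This makes all results on live edges and monomials available for
  \<open>L\<close>.\<close>

sublocale leavitt_family L E "\<lambda>v. cls (vtx v)" "\<lambda>e. cls (edg e)" "\<lambda>e. cls (gho e)"
proof -
  interpret nonassoc_algebra L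
    using dextral_leavitt by (simp add: dextral_symmetric_def)
  show "leavitt_family L E (\<lambda>v. cls (vtx v)) (\<lambda>e. cls (edg e)) (\<lambda>e. cls (gho e))"
  proof
    fix a b c assume "a \<in> acarrier L" "b \<in> acarrier L" "c \<in> acarrier L"
    then obtain s t u where "a = cls s" "b = cls t" "c = cls u" "s \<in> X" "t \<in> X" "u \<in> X"
      by (auto simp: carrier_L)
    then show "amult L (amult L a b) c = amult L a (amult L b c)"
      by (auto simp: cls_eq_iff intro!: presented_cong.axiom assoc_algebra_axiom.mult_assoc)
  next
    show "dextral_symmetric L" by (rule dextral_leavitt)
  next
    \<comment> \<open>The relation gives the class of a formal sum, the locale asks for a sum of
      classes; \<open>cls_foldr\<close> translates.\<close>
    fix v es assume v: "regular_vertex E v" "distinct es" "set es = out_arcs E v"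
    then have es: "set es \<subseteq> arcs E" "v \<in> verts E"
      by (auto simp: regular_vertex_def)
    have "cls (vtx v) = cls (foldr (\<lambda>e. Add (Mult (edg e) (gho e))) es Zero)"
      using v es foldr_exprs by (intro cls_rel lpa_rel.regular) auto
    then show "cls (vtx v) = foldr (\<lambda>e. aadd L (amult L (cls (edg e)) (cls (gho e)))) es (azero L)"
      using cls_foldr[OF es(1)] by simp
  qed (simp add: carrier_L | (rule cls_rel, rule lpa_rel.intros, simp_all))+
qed

text \<open>The values refer to \<open>L\<close> itself: a vertex is sent to 1 only if its class is
  nonzero. Otherwise the coordinates could not descend to classes.\<close>

primrec gen_coord :: "'v \<Rightarrow> ('v, 'e) lpa_gen \<Rightarrow> (int \<Rightarrow>\<^sub>0 'r)" where
  "gen_coord w (Vertex v) = (if v = w \<and> cls (vtx v) \<noteq> azero L then Poly_Mapping.single 0 1 else 0)"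
| "gen_coord w (Edge e) = (if live e \<and> tail E e = w then Poly_Mapping.single 1 1 else 0)"
| "gen_coord w (Ghost e) = (if live e \<and> tail E e = w then Poly_Mapping.single (- 1) 1 else 0)"

abbreviation ev :: "'v \<Rightarrow> ('r, ('v, 'e) lpa_gen) expr \<Rightarrow> (int \<Rightarrow>\<^sub>0 'r)" where
  "ev w \<equiv> eval (gen_coord w) scale_poly"

lemma live_ends: "live e \<Longrightarrow> head E e = tail E e \<and> cls (vtx (tail E e)) \<noteq> cls Zero"
  by (metis live_def live_loop cls_simps(1))

lemma ev_foldr:
  "ev w (foldr (\<lambda>e. Add (Mult (edg e) (gho e))) es Zero) =
    (\<Sum>e\<leftarrow>es. if live e \<and> tail E e = w then Poly_Mapping.single 0 1 else 0)"
  by (induction es) (auto simp: mult_single)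

text \<open>Of two distinct edges at one vertex, one is dead by \<open>live_unique\<close>. A dead
  edge has zero range, so both sides of its relation \<open>ghost_edge\<close> vanish. The regular
  relation balances because a nonzero regular vertex emits exactly one live edge and a zero vertex
  none.\<close>

lemma ev_rel:
  assumes "lpa_rel E s t"
  shows "ev w s = ev w t"
  using assms
proof cases
  case (ghost_edge_neq e f)
  then show ?thesis
    using live_unique by auto
next
  case (ghost_edge e)
  then show ?thesis
  proof (cases "live e")
    case False
    then have "cls (vtx (head E e)) = cls Zero"
      using ghost_edge by (simp add: live_def)
    then show ?thesis
      using False ghost_edge by simp
  qed (simp add: mult_single live_ends)
next
  case (regular v es)
  show ?thesis
  proof (cases "cls (vtx v) = azero L")
    case True
    \<comment> \<open>A live edge at \<open>v\<close> would be a loop, and \<open>v\<close> would be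
      its nonzero range.\<close>
    then have "\<not> live e" if "e \<in> set es" for e
      using that regular by (metis cls_simps(1) in_out_arcs_conv live_ends)
    then have "(\<Sum>e\<leftarrow>es. if live e \<and> tail E e = w then Poly_Mapping.single 0 1 else 0) = (0 :: int \<Rightarrow>\<^sub>0 'r)"
      by (induction es) auto
    then show ?thesis
      using True by (simp add: regular(1,2) ev_foldr)
  next
    case False
    then obtain e0 where e0: "live e0" "tail E e0 = v"
      using regular_has_loop regular(3) by (auto simp: has_loop_def)
    then have e0_es: "e0 \<in> set es"
      using regular by auto
    \<comment> \<open>By \<open>live_unique\<close> no edge other than \<open>e0\<close> contributes
      to the sum.\<close>
    have "live e \<and> tail E e = w \<longleftrightarrow> e = e0 \<and> v = w" if "e \<in> set es" for e
      using that e0 regular live_unique by auto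
    then have "(\<Sum>e\<leftarrow>es. if live e \<and> tail E e = w then Poly_Mapping.single 0 1 else 0) =
        (\<Sum>e\<leftarrow>es. if e = e0 then (if v = w then Poly_Mapping.single 0 1 else 0) else (0 :: int \<Rightarrow>\<^sub>0 'r))"
      by (intro arg_cong[of _ _ sum_list] map_cong) auto
    also have "\<dots> = (if v = w then Poly_Mapping.single 0 1 else 0)"
      using regular(4) e0_es by (simp add: sum_list_distinct_conv_sum_set)
    finally show ?thesis
      using False by (simp add: regular(1,2) ev_foldr)
  qed
qed (auto simp: mult_single live_ends)

section \<open>Coordinates on the algebra\<close>

definition coord :: "('r, ('v, 'e) lpa_gen) expr set \<Rightarrow> 'v \<Rightarrow> (int \<Rightarrow>\<^sub>0 'r)" where
  "coord c w = ev w (SOME s. s \<in> c)"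

text \<open>By \<open>eval_cong\<close> and \<open>ev_rel\<close> the chosen representative does not
  matter.\<close>

lemma coord_cls: "s \<in> X \<Longrightarrow> coord (cls s) w = ev w s"
proof -
  assume "s \<in> X"
  then have "s \<in> cls s"
    by (simp add: cls_def presented_cong.refl)
  then have "(SOME t. t \<in> cls s) \<in> cls s"
    by (rule someI)
  then have "(s, SOME t. t \<in> cls s) \<in> presented_cong (lpa_gens E) (lpa_rel E)"
    by (simp add: cls_def)
  then have "ev w s = ev w (SOME t. t \<in> cls s)"
    by (rule eval_cong) (simp_all add: scale_poly_simps ev_rel)
  then show ?thesis
    by (simp add: coord_def)
qed

lemma coord_zero [simp]: "coord (cls Zero) w = 0"
  by (simp add: coord_cls)

lemma coord_add: "\<lbrakk>a \<in> acarrier L; b \<in> acarrier L\<rbrakk> \<Longrightarrow> coord (aadd L a b) w = coord a w + coord b w"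
  and coord_mult: "\<lbrakk>a \<in> acarrier L; b \<in> acarrier L\<rbrakk> \<Longrightarrow> coord (amult L a b) w = coord a w * coord b w"
  and coord_scale: "a \<in> acarrier L \<Longrightarrow> coord (ascale L r a) w = scale_poly r (coord a w)"
  by (auto simp: carrier_L coord_cls)

section \<open>The monomials form a basis\<close>

lemma coord_mono:
  assumes "(v, n) \<in> mono_index"
  shows "coord (mono_val (v, n)) w = (if v = w then Poly_Mapping.single n 1 else 0)"
proof -
  have v: "v \<in> verts E" "cls (vtx v) \<noteq> cls Zero" "n = 0 \<or> has_loop v"
    using assms by (auto simp: mono_index_def)
  interpret u: unit_pair L "cls (vtx v)" "loop_x v" "loop_y v"
    by (rule unit_pair_loop[OF v(1)])
  have zero: "coord (cls (vtx v)) w = (if v = w then Poly_Mapping.single 0 1 else 0)"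
    using v by (simp add: coord_cls)
  show ?thesis
  proof (cases "has_loop v")
    case False
    then show ?thesis
      using v zero by (simp add: mono_val_def)
  next
    case True
    then obtain e where e: "live e" "tail E e = v"
      by (auto simp: has_loop_def)
    have xy: "coord (loop_x v) w = (if v = w then Poly_Mapping.single 1 1 else 0)"
      "coord (loop_y v) w = (if v = w then Poly_Mapping.single (- 1) 1 else 0)"
      using loop_live[OF e(1)] e by (simp_all add: coord_cls)
    \<comment> \<open>Coordinates are multiplicative, so each step of \<open>zpow\<close> becomes
      multiplication by the variable or its inverse if \<open>v = w\<close>, and by zero
      otherwise.\<close>
    have "coord (zpow (cls (vtx v)) (loop_x v) (loop_y v) n) w =
        (if v = w then Poly_Mapping.single n 1 else 0)"
    proof (induction n rule: int_induct[where k = 0])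
      case (step1 i)
      then show ?case
        using u.zpow_add_one[of i] by (simp add: coord_mult xy mult_single add.commute)
    next
      case (step2 i)
      then show ?case
        by (simp add: u.zpow_diff_one coord_mult xy mult_single)
    qed (simp add: zero)
    then show ?thesis
      by (simp add: mono_val_def)
  qed
qed

text \<open>Coefficients can be read off from coordinates: this is the linear independence of the
  monomials.\<close>

lemma coord_lin_comb:
  "snd ` set xs \<subseteq> mono_index \<Longrightarrow> Poly_Mapping.lookup (coord (lin_comb mono_val xs) w) n = coef xs (w, n)"
proof (induction xs)
  case (Cons z xs)
  obtain r v m where z: "z = (r, (v, m))" by (metis prod.collapse)
  have car: "mono_val (v, m) \<in> acarrier L" "lin_comb mono_val xs \<in> acarrier L"
    using mono_val_closed Cons.prems z by (auto intro!: lin_comb_closed)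
  show ?case
    using Cons car
    by (simp add: z coord_add coord_scale coord_mono lookup_add lookup_single when_def)
qed simp

lemma carrier_span: "acarrier L = span mono_val mono_index"
proof -
  have "cls s \<in> span mono_val mono_index" if "s \<in> X" for s
    using that
  proof (induction s)
    case (Gen g)
    then show ?case
      using p_in_span xy_in_span by (cases g) auto
  next
    case Zero
    then show ?case
      using span_zero by simp
  next
    case (Neg s)
    \<comment> \<open>The algebra record has no negation, so the class of \<open>Neg s\<close> is
      identified with a scalar multiple through uniqueness of additive inverses.\<close>
    have "aadd L (cls s) (cls (Neg s)) = azero L"
      using Neg.prems by (auto simp: cls_eq_iff intro!: presented_cong.axiom assoc_algebra_axiom.add_neg)
    moreover have "cls s \<in> acarrier L" "cls (Neg s) \<in> acarrier L"
      using Neg.prems by (auto simp: carrier_L)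
    ultimately have "cls (Neg s) = ascale L (- 1) (cls s)"
      using add_scale_minus_one add_assoc add_commute add_zero scale_closed by metis
    then show ?case
      using Neg span_scale[OF mono_val_closed, of "cls s" "- 1"] by simp
  next
    case (Add s t)
    then show ?case
      using span_add[OF mono_val_closed, of "cls s" "cls t"] by simp
  next
    case (Mult s t)
    then show ?case
      using span_mult[OF mono_val_closed mono_val_mult, of "cls s" "cls t"] by simp
  next
    case (Scale r s)
    then show ?case
      using span_scale[OF mono_val_closed, of "cls s"] by simp
  qed
  then show ?thesis
    using span_closed[OF mono_val_closed] by (auto simp: carrier_L)
qed

lemma carrier_cases:
  assumes "c \<in> acarrier L"
  obtains xs where "snd ` set xs \<subseteq> mono_index" "c = lin_comb mono_val xs"
  using assms by (auto simp: carrier_span span_def)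

text \<open>Equal coordinates give equal coefficients by \<open>coord_lin_comb\<close>, and these
  give equal elements by \<open>lin_comb_eqI\<close>.\<close>

lemma coord_inject:
  assumes "a \<in> acarrier L" "b \<in> acarrier L" "\<And>w. coord a w = coord b w"
  shows "a = b"
proof -
  obtain xs where xs: "snd ` set xs \<subseteq> mono_index" "a = lin_comb mono_val xs"
    using assms(1) by (rule carrier_cases)
  obtain ys where ys: "snd ` set ys \<subseteq> mono_index" "b = lin_comb mono_val ys"
    using assms(2) by (rule carrier_cases)
  have "coef xs k = coef ys k" for k
    using assms(3)[of "fst k"] coord_lin_comb[OF xs(1), of "fst k" "snd k"]
      coord_lin_comb[OF ys(1), of "fst k" "snd k"] by (simp add: xs(2) ys(2))
  then show ?thesis
    unfolding xs(2) ys(2) using mono_val_closed xs(1) ys(1) by (intro lin_comb_eqI) blast+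
qed

lemma coord_surj:
  assumes "finite K" "K \<subseteq> mono_index"
  shows "\<exists>c\<in>acarrier L. \<forall>w n. Poly_Mapping.lookup (coord c w) n = (if (w, n) \<in> K then f w n else 0)"
proof -
  obtain ks where ks: "set ks = K" "distinct ks"
    using finite_distinct_list[OF assms(1)] by blast
  let ?xs = "map (\<lambda>k. (case_prod f k, k)) ks"
  have xs: "snd ` set ?xs \<subseteq> mono_index"
    using ks assms(2) by auto
  show ?thesis
  proof (intro bexI allI)
    show "lin_comb mono_val ?xs \<in> acarrier L"
      using xs mono_val_closed by (intro lin_comb_closed) blast
    show "Poly_Mapping.lookup (coord (lin_comb mono_val ?xs) w) n = (if (w, n) \<in> K then f w n else 0)" for w n
      using coord_lin_comb[OF xs] coef_map_distinct[OF ks(2), of "case_prod f"] ks(1) by simp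
  qed
qed

lemma coord_mono_index:
  assumes "c \<in> acarrier L" "Poly_Mapping.lookup (coord c w) n \<noteq> 0"
  shows "(w, n) \<in> mono_index"
proof -
  obtain xs where "snd ` set xs \<subseteq> mono_index" "c = lin_comb mono_val xs"
    using assms(1) by (rule carrier_cases)
  then show ?thesis
    using assms(2) coord_lin_comb coef_nonzero_imp_key by fastforce
qed

text \<open>Only vertices occurring in a list that represents \<open>c\<close> can carry a nonzero
  coordinate.\<close>

lemma finite_coord:
  assumes "c \<in> acarrier L"
  shows "finite {w. coord c w \<noteq> 0}"
proof -
  obtain xs where xs: "snd ` set xs \<subseteq> mono_index" "c = lin_comb mono_val xs"
    using assms by (rule carrier_cases)
  have "{w. coord c w \<noteq> 0} \<subseteq> fst ` snd ` set xs"
  proof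
    fix w assume "w \<in> {w. coord c w \<noteq> 0}"
    then obtain n where "Poly_Mapping.lookup (coord c w) n \<noteq> 0"
      by (auto simp: poly_mapping_eq_iff fun_eq_iff)
    then have "(w, n) \<in> snd ` set xs"
      using coord_lin_comb[OF xs(1)] xs(2) coef_nonzero_imp_key by metis
    then show "w \<in> fst ` snd ` set xs"
      by force
  qed
  then show ?thesis
    by (rule finite_subset) simp
qed

text \<open>Sinks with regard to live edges. They index the copies of \<open>R\<close>, and
  \<open>loops\<close> indexes the Laurent algebras.\<close>

definition sinks :: "'v set" where
  "sinks = {v \<in> verts E. cls (vtx v) \<noteq> azero L \<and> \<not> has_loop v}"

definition loops :: "'v set" where
  "loops = {v. has_loop v}"

lemma sinks_loops_disjoint: "v \<in> sinks \<Longrightarrow> v \<notin> loops"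
  by (simp add: sinks_def loops_def)

lemma mono_index_iff: "(v, n) \<in> mono_index \<longleftrightarrow> v \<in> loops \<or> v \<in> sinks \<and> n = 0"
  unfolding mono_index_def sinks_def loops_def mem_Collect_eq prod.case
  using has_loopD[of v] by argo

text \<open>At a sink only the constant coefficient can be nonzero, by \<open>coord_sink\<close>, so
  keeping that one alone loses nothing. The restrictions make the components extensional, as
  \<open>direct_sum\<close> requires.\<close>

definition coord_map :: "('r, ('v, 'e) lpa_gen) expr set \<Rightarrow> ('v \<Rightarrow> 'r) \<times> ('v \<Rightarrow> (int \<Rightarrow>\<^sub>0 'r))" where
  "coord_map c = (\<lambda>v\<in>sinks. Poly_Mapping.lookup (coord c v) 0, \<lambda>v\<in>loops. coord c v)"

lemma coord_sink:
  assumes "c \<in> acarrier L" "v \<in> sinks"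
  shows "coord c v = Poly_Mapping.single 0 (Poly_Mapping.lookup (coord c v) 0)"
proof (rule poly_mapping_eqI)
  show "Poly_Mapping.lookup (coord c v) n =
      Poly_Mapping.lookup (Poly_Mapping.single 0 (Poly_Mapping.lookup (coord c v) 0)) n" for n
    using coord_mono_index[OF assms(1), of v n] assms(2) sinks_loops_disjoint
    by (auto simp: lookup_single when_def mono_index_iff)
qed

lemma coord_outside:
  assumes "c \<in> acarrier L" "v \<notin> sinks" "v \<notin> loops"
  shows "coord c v = 0"
proof (rule poly_mapping_eqI)
  show "Poly_Mapping.lookup (coord c v) n = Poly_Mapping.lookup 0 n" for n
    using coord_mono_index[OF assms(1), of v n] assms(2,3) by (auto simp: mono_index_iff)
qed

section \<open>The isomorphism onto the direct sum\<close>

abbreviation target :: "('r, ('v \<Rightarrow> 'r) \<times> ('v \<Rightarrow> (int \<Rightarrow>\<^sub>0 'r))) algebra" where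
  "target \<equiv> binary_direct_sum (direct_sum sinks (\<lambda>_. ground_algebra))
    (direct_sum loops (\<lambda>_. laurent_algebra))"

lemmas target_defs = binary_direct_sum_def direct_sum_def ground_algebra_def laurent_algebra_def

text \<open>The retained data determine every coordinate: those at sinks are constants and those
  outside \<open>sinks\<close> and \<open>loops\<close> vanish.\<close>

lemma coord_map_inj: "inj_on coord_map (acarrier L)"
proof (rule inj_onI)
  fix a b assume ab: "a \<in> acarrier L" "b \<in> acarrier L" and eq: "coord_map a = coord_map b"
  have "coord a w = coord b w" for w
  proof -
    consider "w \<in> sinks" | "w \<in> loops" | "w \<notin> sinks" "w \<notin> loops" by blast
    then show ?thesis
    proof cases
      case 1
      have "fst (coord_map a) w = fst (coord_map b) w"
        using eq by simp
      then have "Poly_Mapping.lookup (coord a w) 0 = Poly_Mapping.lookup (coord b w) 0"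
        using 1 by (simp add: coord_map_def)
      then show ?thesis
        using coord_sink[OF ab(1) 1] coord_sink[OF ab(2) 1] by simp
    next
      case 2
      have "snd (coord_map a) w = snd (coord_map b) w"
        using eq by simp
      then show ?thesis
        using 2 by (simp add: coord_map_def)
    next
      case 3
      then show ?thesis
        using ab by (simp add: coord_outside)
    qed
  qed
  then show "a = b"
    using ab by (intro coord_inject)
qed

lemma coord_map_image: "coord_map ` acarrier L = acarrier target"
proof
  show "coord_map ` acarrier L \<subseteq> acarrier target"
  proof
    fix z assume "z \<in> coord_map ` acarrier L"
    then obtain c where c: "c \<in> acarrier L" "z = coord_map c" by blast
    have "finite {v \<in> sinks. Poly_Mapping.lookup (coord c v) 0 \<noteq> 0}" "finite {v \<in> loops. coord c v \<noteq> 0}"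
      by (rule finite_subset[OF _ finite_coord[OF c(1)]]; auto)+
    moreover have "{v \<in> sinks. (\<lambda>v\<in>sinks. Poly_Mapping.lookup (coord c v) 0) v \<noteq> 0} = {v \<in> sinks. Poly_Mapping.lookup (coord c v) 0 \<noteq> 0}"
      "{v \<in> loops. (\<lambda>v\<in>loops. coord c v) v \<noteq> 0} = {v \<in> loops. coord c v \<noteq> 0}"
      by auto
    ultimately show "z \<in> acarrier target"
      by (simp add: c(2) coord_map_def target_defs)
  qed
next
  show "acarrier target \<subseteq> coord_map ` acarrier L"
  proof
    fix z assume "z \<in> acarrier target"
    then obtain f g where z: "z = (f, g)" "f \<in> extensional sinks" "finite {v \<in> sinks. f v \<noteq> 0}"
      "g \<in> extensional loops" "finite {v \<in> loops. g v \<noteq> 0}"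
      by (cases z) (auto simp: target_defs PiE_def)
    \<comment> \<open>\<open>K\<close> is the support of the pair, as a set of monomial indices. It
      is finite because both components have finite support and each Laurent polynomial has finitely
      many terms.\<close>
    define K where "K = (\<lambda>v. (v, 0)) ` {v \<in> sinks. f v \<noteq> 0} \<union>
        (SIGMA v:{v \<in> loops. g v \<noteq> 0}. Poly_Mapping.keys (g v))"
    have "finite K"
      using z by (auto simp: K_def)
    moreover have "K \<subseteq> mono_index"
      by (auto simp: K_def mono_index_iff)
    ultimately obtain c where c: "c \<in> acarrier L" "\<And>w n. Poly_Mapping.lookup (coord c w) n =
        (if (w, n) \<in> K then (if w \<in> sinks then f w else Poly_Mapping.lookup (g w) n) else 0)"
      using coord_surj[of K "\<lambda>w n. if w \<in> sinks then f w else Poly_Mapping.lookup (g w) n"] by blast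
    \<comment> \<open>Disjointness of \<open>sinks\<close> and \<open>loops\<close> keeps the two
      parts of \<open>K\<close> apart.\<close>
    have "Poly_Mapping.lookup (coord c v) 0 = f v" if "v \<in> sinks" for v
      using that sinks_loops_disjoint by (auto simp: c(2) K_def)
    moreover have "coord c v = g v" if "v \<in> loops" for v
      using that sinks_loops_disjoint
      by (intro poly_mapping_eqI) (auto simp: c(2) K_def in_keys_iff)
    ultimately have "coord_map c = z"
      using z by (auto simp: coord_map_def extensional_def)
    then show "z \<in> coord_map ` acarrier L"
      using c(1) by blast
  qed
qed

lemma algebra_iso_target: "algebra_iso L target coord_map"
proof -
  \<comment> \<open>Taking the constant coefficient is not multiplicative for Laurent polynomials in
    general; it is here, because both factors are constants.\<close>
  have mult_sink: "Poly_Mapping.lookup (coord a v * coord b v) 0 = Poly_Mapping.lookup (coord a v) 0 * Poly_Mapping.lookup (coord b v) 0"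
    if ab: "a \<in> acarrier L" "b \<in> acarrier L" and v: "v \<in> sinks" for a b v
    by (subst coord_sink[OF ab(1) v], subst coord_sink[OF ab(2) v]) (simp add: mult_single)
  show ?thesis
    unfolding algebra_iso_def bij_betw_def
    using coord_map_inj coord_map_image
    by (auto simp: coord_map_def target_defs coord_add coord_mult coord_scale lookup_add mult_sink
        intro!: restrict_ext)
qed

end

theorem theorem3p7:
  fixes E :: "('v, 'e) pre_digraph"
  assumes "wf_digraph E" and "countable (verts E)" and "countable (arcs E)"
    and "dextral_symmetric
      (leavitt_path_algebra TYPE('r::{comm_ring, comm_monoid_mult}) E)"
  shows "\<exists>(I :: 'v set) (J :: 'v set).
    algebra_isomorphic (leavitt_path_algebra TYPE('r) E)
      (binary_direct_sum (direct_sum I (\<lambda>_. ground_algebra)) (direct_sum J (\<lambda>_. laurent_algebra)))"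
proof -
  interpret wf_digraph E by (rule assms(1))
  interpret dextral_leavitt E "TYPE('r)"
    by unfold_locales (rule assms(4))
  show ?thesis
    using algebra_iso_target unfolding algebra_isomorphic_def by blast
qed

end
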